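(* Let $X$ be a $\mathsf{cs}$-Ascoli normal $\aleph$-space. Then each $\mathsf{cs}$-network $\mathcal N$ in $X$ is an $\mathsf{as}$-network. Consequently, every $\mathsf{cs}$-Ascoli normal $\aleph$-space is a $\sigma_{\mathsf{as}}$-space.
   Context: Regular spaces are assumed to be Hausdorff. Let $\mathcal N$ be a family of subsets of a topological space $X$. $\mathcal N$ is a $k$-network if for each open set $U\subseteq X$ and compact set $K\subseteq U$ there exists a finite subfamily $\mathcal F\subseteq\mathcal N$ such that $K\subseteq\bigcup\mathcal F\subseteq U$. $\mathcal N$ is a $\mathsf{cs}$-network if for each open set $U\subseteq X$ and each sequence $(x_n)_{n\in\omega}$ of points of $X$ converging to a point $x\in U$ there exists $N\in\mathcal N$ such that $N\subseteq U$ and the set $\{n\in\omega:x_n\in N\}$ is infinite. A sequence $(S_n)_{n\in\omega}$ of closed subsets of $X$ accumulates at a point $x\in X$ if for each neighborhood $O_x$ of $x$ the set $\{n\in\omega:O_x\cap S_n\neq\emptyset\}$ is infinite. $\mathcal N$ is an $\mathsf{as}$-network if for each open set $U\subseteq X$ and each sequence $(S_n)_{n\in\omega}$ of closed subsets of $X$ that accumulates at a point $x\in U$ there exists $N\in\mathcal N$ such that $N\subseteq U$ and the set $\{n\in\omega:N\cap S_n\neq\emptyset\}$ is infinite. A family of subsets of $X$ is discrete if each point of $X$ has a neighborhood meeting at most one member of the family, and $\sigma$-discrete if it is a countable union of discrete families. A regular topological space is an $\aleph$-space if it has a $\sigma$-discrete $k$-network, and a $\sigma_{\mathsf{as}}$-space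 if it has a $\sigma$-discrete $\mathsf{as}$-network. (A regular space is an $\aleph$-space if and only if it has a $\sigma$-discrete $\mathsf{cs}$-network.) $C_k(X)$ denotes the set of all continuous functions $X\to\mathbb R$ with the compact-open topology. A convergent sequence is a compact countable set with a unique non-isolated point. A topological space $X$ is $\mathsf{cs}$-Ascoli (sequentially Ascoli) if for any convergent sequence $K\subseteq C_k(X)$ the map $K\times X\to\mathbb R$, $(f,x)\mapsto f(x)$, is continuous. *)

theory Defs
  imports "HOL-Analysis.Analysis"
begin

section \<open>Networks\<close>

definition k_network :: "'a topology \<Rightarrow> 'a set set \<Rightarrow> bool" where
  "k_network X \<N> \<longleftrightarrow> \<N> \<subseteq> Pow (topspace X) \<and>
     (\<forall>U K. openin X U \<and> compactin X K \<and> K \<subseteq> U \<longrightarrow>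
        (\<exists>\<F>. finite \<F> \<and> \<F> \<subseteq> \<N> \<and> K \<subseteq> \<Union>\<F> \<and> \<Union>\<F> \<subseteq> U))"

text \<open>Only infinitely many terms of the sequence have to lie in the chosen member, not all but
  finitely many (some authors call this notion a cs*-network).\<close>

definition cs_network :: "'a topology \<Rightarrow> 'a set set \<Rightarrow> bool" where
  "cs_network X \<N> \<longleftrightarrow> \<N> \<subseteq> Pow (topspace X) \<and>
     (\<forall>U (s :: nat \<Rightarrow> 'a) x.
        openin X U \<and> range s \<subseteq> topspace X \<and> limitin X s x sequentially \<and> x \<in> U \<longrightarrow>
        (\<exists>N\<in>\<N>. N \<subseteq> U \<and> infinite {n. s n \<in> N}))"

definition accumulates_at :: "'a topology \<Rightarrow> (nat \<Rightarrow> 'a set) \<Rightarrow> 'a \<Rightarrow> bool" where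
  "accumulates_at X S x \<longleftrightarrow> x \<in> topspace X \<and>
     (\<forall>V. openin X V \<and> x \<in> V \<longrightarrow> infinite {n. V \<inter> S n \<noteq> {}})"

definition as_network :: "'a topology \<Rightarrow> 'a set set \<Rightarrow> bool" where
  "as_network X \<N> \<longleftrightarrow> \<N> \<subseteq> Pow (topspace X) \<and>
     (\<forall>U (S :: nat \<Rightarrow> 'a set) x.
        openin X U \<and> (\<forall>n. closedin X (S n)) \<and> accumulates_at X S x \<and> x \<in> U \<longrightarrow>
        (\<exists>N\<in>\<N>. N \<subseteq> U \<and> infinite {n. N \<inter> S n \<noteq> {}}))"

section \<open>Discrete families and classes of spaces\<close>

definition discrete_family :: "'a topology \<Rightarrow> 'a set set \<Rightarrow> bool" where
  "discrete_family X \<D> \<longleftrightarrow> \<D> \<subseteq> Pow (topspace X) \<and>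
     (\<forall>x\<in>topspace X. \<exists>V. openin X V \<and> x \<in> V \<and>
        (\<forall>A\<in>\<D>. \<forall>B\<in>\<D>. A \<inter> V \<noteq> {} \<and> B \<inter> V \<noteq> {} \<longrightarrow> A = B))"

definition sigma_discrete :: "'a topology \<Rightarrow> 'a set set \<Rightarrow> bool" where
  "sigma_discrete X \<N> \<longleftrightarrow>
     (\<exists>\<D> :: nat \<Rightarrow> 'a set set. (\<forall>n. discrete_family X (\<D> n)) \<and> \<N> = (\<Union>n. \<D> n))"

text \<open>Regular spaces are Hausdorff by convention, whereas \<^const>\<open>regular_space\<close> does not
  include any separation axiom for points.\<close>

definition aleph_space :: "'a topology \<Rightarrow> bool" where
  "aleph_space X \<longleftrightarrow> regular_space X \<and> Hausdorff_space X \<and>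
     (\<exists>\<N>. sigma_discrete X \<N> \<and> k_network X \<N>)"

definition sigma_as_space :: "'a topology \<Rightarrow> bool" where
  "sigma_as_space X \<longleftrightarrow> regular_space X \<and> Hausdorff_space X \<and>
     (\<exists>\<N>. sigma_discrete X \<N> \<and> as_network X \<N>)"

section \<open>The space of continuous functions and the Ascoli property\<close>

text \<open>Functions on \<^term>\<open>topspace X\<close> are represented by extensional functions, so that
  a continuous real function on the space corresponds to exactly one point of the function space.\<close>

definition cont_funs :: "'a topology \<Rightarrow> ('a \<Rightarrow> real) set" where
  "cont_funs X = {f \<in> extensional (topspace X). continuous_map X euclideanreal f}"

definition compact_open_topology :: "'a topology \<Rightarrow> ('a \<Rightarrow> real) topology" where
  "compact_open_topology X = topology_generated_by
     {{f \<in> cont_funs X. f ` K \<subseteq> U} | K U. compactin X K \<and> open U}"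

lemma topspace_compact_open_topology [simp]:
  "topspace (compact_open_topology X) = cont_funs X"
proof -
  have "{f \<in> cont_funs X. f ` {} \<subseteq> (UNIV :: real set)} \<in>
      {{f \<in> cont_funs X. f ` K \<subseteq> U} | K U. compactin X K \<and> open U}"
    using compactin_empty open_UNIV by blast
  then show ?thesis
    unfolding compact_open_topology_def topology_generated_by_topspace by fastforce
qed

definition convergent_sequence_in :: "'b topology \<Rightarrow> 'b set \<Rightarrow> bool" where
  "convergent_sequence_in Y K \<longleftrightarrow> compactin Y K \<and> countable K \<and>
     (\<exists>!x. x \<in> K \<and> \<not> openin (subtopology Y K) {x})"

definition cs_Ascoli :: "'a topology \<Rightarrow> bool" where
  "cs_Ascoli X \<longleftrightarrow>
     (\<forall>K. convergent_sequence_in (compact_open_topology X) K \<longrightarrow>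
        continuous_map (prod_topology (subtopology (compact_open_topology X) K) X)
          euclideanreal (\<lambda>(f, x). f x))"

end

theory Submission
  imports Defs
begin

text \<open>
  It suffices to find, whenever closed sets \<open>S n\<close> accumulate at a point \<open>x\<close> of an open set \<open>U\<close>, a
  sequence that converges to a point of \<open>U\<close> and whose terms are picked from the sets \<open>S n\<close> for a
  strictly increasing sequence of indices: a cs-network then contains a member inside \<open>U\<close> that
  catches infinitely many of the terms and therefore meets infinitely many of the \<open>S n\<close>. To keep
  the limit inside \<open>U\<close> the sets are first cut down to a closed neighbourhood of \<open>x\<close>
  (\<open>cs_network_imp_as_network\<close>).

  By regularity an \<open>\<aleph>\<close>-space has a k-network of closed sets arranged in increasing, locally
  finite levels. For each \<open>n\<close> and each point \<open>a\<close>, let \<open>core n a\<close> be the open neighbourhood of \<open>a\<close>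
  left after removing all members of level \<open>n\<close> that miss \<open>a\<close>. Inside a compact set the cores of a
  point form a neighbourhood base, so compact sets are sequentially compact
  (\<open>compactin_imp_convergent_subsequence\<close>). Moreover, if points \<open>q n\<close> converge and \<open>q n\<close> lies in
  \<open>core (r n) (a n)\<close> with \<open>r n\<close> strictly increasing, then the \<open>a n\<close> converge to the same limit
  (\<open>limitin_of_core\<close>).

  Now expand \<open>S n\<close> to the open set \<open>\<Union>a\<in>S n. core n a\<close>. If some compact set meets infinitely many
  of these expansions, the two facts yield the sequence sought (\<open>convergent_selection\<close>).
  Otherwise normality provides continuous functions that are \<open>1\<close> on \<open>S n\<close> and \<open>0\<close> off the
  expansion; on each compact set almost all of them vanish, so together with the zero function they
  form a convergent sequence in the function space. The cs-Ascoli property makes evaluation jointly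
  continuous on it, which gives \<open>x\<close> a neighbourhood where almost all of the functions stay below
  \<open>1\<close>. That neighbourhood meets only finitely many \<open>S n\<close>, contradicting accumulation
  (\<open>cs_Ascoli_compact_finite_expansion\<close>).

  The second claim follows because a k-network is a cs-network: a tail of a convergent sequence
  together with its limit is compact, and one of finitely many covering sets contains infinitely
  many terms.
\<close>

section \<open>Cluster points and convergent sequences\<close>

lemma compactin_imp_cluster_point:
  fixes s :: "nat \<Rightarrow> 'a"
  assumes K: "compactin X K" and s: "\<And>n. s n \<in> K"
  shows "\<exists>p\<in>K. \<forall>V. openin X V \<and> p \<in> V \<longrightarrow> infinite {n. s n \<in> V}"
proof (rule ccontr)
  assume "\<not> ?thesis"
  then have "\<forall>p\<in>K. \<exists>V. openin X V \<and> p \<in> V \<and> finite {n. s n \<in> V}"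
    by blast
  then obtain V where V: "\<And>p. p \<in> K \<Longrightarrow> openin X (V p) \<and> p \<in> V p \<and> finite {n. s n \<in> V p}"
    by metis
  have "\<exists>\<F>. finite \<F> \<and> \<F> \<subseteq> V ` K \<and> K \<subseteq> \<Union>\<F>"
    using V by (intro compactinD[OF K]) auto
  then obtain \<F> where \<F>: "finite \<F>" "\<F> \<subseteq> V ` K" "K \<subseteq> \<Union>\<F>"
    by blast
  have "finite (\<Union>W\<in>\<F>. {n. s n \<in> W})"
    using \<F>(1,2) V by (intro finite_UN_I) auto
  moreover have "(\<Union>W\<in>\<F>. {n. s n \<in> W}) = UNIV"
    using \<F>(3) s by blast
  ultimately show False
    by simp
qed

text \<open>Each term differs from the limit, hence is separated from a tail of the sequence: it
  recurs only finitely often and is isolated. The limit is not isolated because the terms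
  that come near it are not equal to it.\<close>

lemma convergent_sequence_in_insert_range:
  fixes f :: "nat \<Rightarrow> 'b"
  assumes Y: "Hausdorff_space Y" and lim: "limitin Y f l sequentially"
    and f: "range f \<subseteq> topspace Y" and ne: "\<And>n. f n \<noteq> l"
  shows "convergent_sequence_in Y (insert l (range f))" (is "convergent_sequence_in Y ?K")
proof -
  have l: "l \<in> topspace Y"
    using lim limitin_topspace by metis
  have isolated: "openin (subtopology Y ?K) {f n}" for n
  proof -
    obtain V W where VW: "openin Y V" "openin Y W" "f n \<in> V" "l \<in> W" "disjnt V W"
      using Y l f ne[of n] unfolding Hausdorff_space_def by (metis rangeI subsetD)
    obtain N where N: "\<And>m. N \<le> m \<Longrightarrow> f m \<in> W"
      using lim VW(2,4) unfolding limitin_sequentially by blast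
    have "?K \<inter> V \<subseteq> f ` {..<N}"
    proof
      fix y assume y: "y \<in> ?K \<inter> V"
      then obtain m where "y = f m"
        using VW(4,5) by (auto simp: disjnt_iff)
      moreover from this have "m < N"
        using y N VW(5) by (meson IntD2 disjnt_iff not_le)
      ultimately show "y \<in> f ` {..<N}"
        by blast
    qed
    then have "finite (?K \<inter> V - {f n})"
      by (meson finite_Diff finite_imageI finite_lessThan finite_subset)
    moreover have "?K \<inter> V - {f n} \<subseteq> topspace Y"
      using f l by auto
    ultimately have "closedin Y (?K \<inter> V - {f n})"
      using Y Hausdorff_imp_t1_space t1_space_closedin_finite by metis
    then have "openin Y (V - (?K \<inter> V - {f n}))"
      using VW(1) by blast
    moreover have "{f n} = ?K \<inter> (V - (?K \<inter> V - {f n}))"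
      using VW(3) by auto
    ultimately show ?thesis
      by (metis openin_subtopology_Int2)
  qed
  have accumulation: "\<not> openin (subtopology Y ?K) {l}"
  proof
    assume "openin (subtopology Y ?K) {l}"
    then obtain V where V: "openin Y V" "{l} = V \<inter> ?K"
      by (auto simp: openin_subtopology)
    then have "l \<in> V"
      by blast
    then obtain N where "f N \<in> V"
      using lim V(1) unfolding limitin_sequentially by blast
    then have "f N \<in> {l}"
      using V(2) by blast
    then show False
      using ne by blast
  qed
  have "compactin Y ?K"
    using compactin_sequence_with_limit[OF lim order_refl f] .
  then show ?thesis
    using isolated accumulation unfolding convergent_sequence_in_def by auto
qed

lemma k_network_imp_cs_network:
  assumes "k_network X \<N>"
  shows "cs_network X \<N>"
  unfolding cs_network_def
proof (intro conjI allI impI)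
  show "\<N> \<subseteq> Pow (topspace X)"
    using assms by (simp add: k_network_def)
  fix U and s :: "nat \<Rightarrow> 'a" and x
  assume A: "openin X U \<and> range s \<subseteq> topspace X \<and> limitin X s x sequentially \<and> x \<in> U"
  then obtain M where M: "\<And>n. M \<le> n \<Longrightarrow> s n \<in> U"
    unfolding limitin_sequentially by blast
  have "compactin X (insert x (s ` {M..}))"
    using A by (intro compactin_sequence_with_limit[of X s]) auto
  moreover have "insert x (s ` {M..}) \<subseteq> U"
    using A M by auto
  ultimately obtain \<F> where \<F>: "finite \<F>" "\<F> \<subseteq> \<N>" "insert x (s ` {M..}) \<subseteq> \<Union>\<F>" "\<Union>\<F> \<subseteq> U"
    using assms A unfolding k_network_def by meson
  have "{M..} \<subseteq> (\<Union>N\<in>\<F>. {n. s n \<in> N})"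
    using \<F>(3) by auto
  then have "infinite (\<Union>N\<in>\<F>. {n. s n \<in> N})"
    using infinite_Ici infinite_super by blast
  then obtain N where "N \<in> \<F>" "infinite {n. s n \<in> N}"
    using \<F>(1) by blast
  then show "\<exists>N\<in>\<N>. N \<subseteq> U \<and> infinite {n. s n \<in> N}"
    using \<F>(2,4) by blast
qed

section \<open>Closed k-networks arranged in locally finite levels\<close>

text \<open>Local finiteness makes the union of any subfamily of a level closed. That can fail for subfamilies
  of the whole k-network, but every finite subfamily lies in a single level because the levels
  increase.\<close>

locale leveled_k_network =
  fixes X :: "'a topology" and L :: "nat \<Rightarrow> 'a set set"
  assumes closed: "D \<in> L n \<Longrightarrow> closedin X D"
    and locally_finite: "locally_finite_in X (L n)"
    and mono: "m \<le> n \<Longrightarrow> L m \<subseteq> L n"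
    and k_network: "k_network X (\<Union>n. L n)"

lemma discrete_family_imp_locally_finite_in:
  assumes "discrete_family X \<D>"
  shows "locally_finite_in X \<D>"
  unfolding locally_finite_in_def
proof (intro conjI ballI)
  show "\<Union>\<D> \<subseteq> topspace X"
    using assms by (auto simp: discrete_family_def)
  fix x assume "x \<in> topspace X"
  then obtain V where V: "openin X V" "x \<in> V"
      "\<And>A B. A \<in> \<D> \<Longrightarrow> B \<in> \<D> \<Longrightarrow> A \<inter> V \<noteq> {} \<Longrightarrow> B \<inter> V \<noteq> {} \<Longrightarrow> A = B"
    using assms unfolding discrete_family_def by meson
  have "finite {U \<in> \<D>. U \<inter> V \<noteq> {}}"
  proof (cases "\<exists>A\<in>\<D>. A \<inter> V \<noteq> {}")
    case True
    then obtain A where "A \<in> \<D>" "A \<inter> V \<noteq> {}"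
      by blast
    then have "{U \<in> \<D>. U \<inter> V \<noteq> {}} \<subseteq> {A}"
      using V(3) by blast
    then show ?thesis
      using finite_subset by blast
  next
    case False
    then have "{U \<in> \<D>. U \<inter> V \<noteq> {}} = {}"
      by blast
    then show ?thesis
      by (metis finite.emptyI)
  qed
  then show "\<exists>V. openin X V \<and> x \<in> V \<and> finite {U \<in> \<D>. U \<inter> V \<noteq> {}}"
    using V by blast
qed

lemma locally_finite_in_Union_finite:
  assumes "finite I" and "\<And>i. i \<in> I \<Longrightarrow> locally_finite_in X (\<D> i)"
  shows "locally_finite_in X (\<Union>i\<in>I. \<D> i)"
  unfolding locally_finite_in_def
proof (intro conjI ballI)
  show "\<Union>(\<Union>i\<in>I. \<D> i) \<subseteq> topspace X"
    using assms(2) unfolding locally_finite_in_def by blast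
  fix x assume x: "x \<in> topspace X"
  then have "\<forall>i\<in>I. \<exists>V. openin X V \<and> x \<in> V \<and> finite {U \<in> \<D> i. U \<inter> V \<noteq> {}}"
    using assms(2) unfolding locally_finite_in_def by blast
  then obtain V where V: "\<And>i. i \<in> I \<Longrightarrow> openin X (V i) \<and> x \<in> V i \<and> finite {U \<in> \<D> i. U \<inter> V i \<noteq> {}}"
    by metis
  define W where "W = topspace X \<inter> (\<Inter>i\<in>I. V i)"
  have "openin X W"
    unfolding W_def using assms(1) V
    by (cases "I = {}") (auto intro!: openin_Int openin_INT)
  moreover have "x \<in> W"
    using x V by (auto simp: W_def)
  moreover have "{U \<in> (\<Union>i\<in>I. \<D> i). U \<inter> W \<noteq> {}} \<subseteq> (\<Union>i\<in>I. {U \<in> \<D> i. U \<inter> V i \<noteq> {}})"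
    by (auto simp: W_def)
  then have "finite {U \<in> (\<Union>i\<in>I. \<D> i). U \<inter> W \<noteq> {}}"
    by (rule finite_subset) (use assms(1) V in auto)
  ultimately show "\<exists>W. openin X W \<and> x \<in> W \<and> finite {U \<in> (\<Union>i\<in>I. \<D> i). U \<inter> W \<noteq> {}}"
    by blast
qed

text \<open>By regularity a compact set can be covered inside an open set whose closure still lies
  in the prescribed neighbourhood, so the covering members may be replaced by their closures.\<close>

lemma k_network_closure:
  assumes X: "regular_space X" and \<N>: "k_network X \<N>"
  shows "k_network X ((closure_of) X ` \<N>)"
  unfolding k_network_def
proof (intro conjI allI impI)
  show "(closure_of) X ` \<N> \<subseteq> Pow (topspace X)"
    using closure_of_subset_topspace by fast
  fix U K assume UK: "openin X U \<and> compactin X K \<and> K \<subseteq> U"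
  have "closedin X (topspace X - U)" "disjnt K (topspace X - U)"
    using UK by (auto simp: disjnt_iff)
  then obtain V W where VW: "openin X V" "openin X W" "K \<subseteq> V" "topspace X - U \<subseteq> W" "disjnt V W"
    using regular_space_compact_closed_separation[OF X] UK by metis
  obtain \<F> where \<F>: "finite \<F>" "\<F> \<subseteq> \<N>" "K \<subseteq> \<Union>\<F>" "\<Union>\<F> \<subseteq> V"
    using \<N> VW(1,3) UK unfolding k_network_def by meson
  have "X closure_of A \<subseteq> U" if "A \<in> \<F>" for A
  proof -
    have "A \<subseteq> topspace X - W"
      using that \<F>(4) VW(5) openin_subset[OF VW(1)] by (auto simp: disjnt_iff)
    then have "X closure_of A \<subseteq> topspace X - W"
      using VW(2) by (intro closure_of_minimal) auto
    then show ?thesis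
      using VW(4) by blast
  qed
  moreover have "A \<subseteq> X closure_of A" if "A \<in> \<F>" for A
    using that \<F>(2) \<N> by (intro closure_of_subset) (auto simp: k_network_def)
  then have "\<Union>\<F> \<subseteq> \<Union>((closure_of) X ` \<F>)"
    by blast
  ultimately have "finite ((closure_of) X ` \<F>) \<and> (closure_of) X ` \<F> \<subseteq> (closure_of) X ` \<N> \<and>
      K \<subseteq> \<Union>((closure_of) X ` \<F>) \<and> \<Union>((closure_of) X ` \<F>) \<subseteq> U"
    using \<F>(1-3) by (simp add: UN_least image_mono order_trans[OF \<F>(3)])
  then show "\<exists>\<F>'. finite \<F>' \<and> \<F>' \<subseteq> (closure_of) X ` \<N> \<and> K \<subseteq> \<Union>\<F>' \<and> \<Union>\<F>' \<subseteq> U"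
    by blast
qed

lemma aleph_space_imp_leveled_k_network:
  assumes "aleph_space X"
  shows "\<exists>L. leveled_k_network X L"
proof -
  obtain \<N> where X: "regular_space X" and \<N>: "sigma_discrete X \<N>" "k_network X \<N>"
    using assms unfolding aleph_space_def by blast
  then obtain \<D> :: "nat \<Rightarrow> 'a set set"
    where \<D>: "\<And>n. discrete_family X (\<D> n)" "\<N> = (\<Union>n. \<D> n)"
    unfolding sigma_discrete_def by blast
  have "leveled_k_network X (\<lambda>n. (closure_of) X ` (\<Union>k\<le>n. \<D> k))"
  proof
    show "locally_finite_in X ((closure_of) X ` (\<Union>k\<le>n. \<D> k))" for n
      using \<D>(1) by (intro locally_finite_in_closure locally_finite_in_Union_finite
          discrete_family_imp_locally_finite_in) auto
    have "(\<Union>n. (closure_of) X ` (\<Union>k\<le>n. \<D> k)) = (closure_of) X ` \<N>"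
      unfolding \<D>(2) by blast
    then show "k_network X (\<Union>n. (closure_of) X ` (\<Union>k\<le>n. \<D> k))"
      using k_network_closure[OF X \<N>(2)] by simp
    show "m \<le> n \<Longrightarrow> (closure_of) X ` (\<Union>k\<le>m. \<D> k) \<subseteq> (closure_of) X ` (\<Union>k\<le>n. \<D> k)" for m n
      by (intro image_mono UN_mono) auto
  qed auto
  then show ?thesis
    by blast
qed

context leveled_k_network
begin

text \<open>The relation \<open>q \<in> core n p\<close> is used in two ways. As \<open>q\<close> varies it describes an open
  neighbourhood of \<open>p\<close>, the complement of the level-\<open>n\<close> members that miss \<open>p\<close>; for given \<open>q\<close> it
  confines \<open>p\<close> to the intersection of the level-\<open>n\<close> members around \<open>q\<close>.\<close>

definition core :: "nat \<Rightarrow> 'a \<Rightarrow> 'a set" where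
  "core n p = {q \<in> topspace X. \<forall>D\<in>L n. q \<in> D \<longrightarrow> p \<in> D}"

lemma openin_core: "openin X (core n p)"
proof -
  have "closedin X (\<Union>{D \<in> L n. p \<notin> D})"
  proof (rule closedin_locally_finite_Union)
    show "locally_finite_in X {D \<in> L n. p \<notin> D}"
      using locally_finite by (rule locally_finite_in_subset) blast
  qed (use closed in blast)
  moreover have "core n p = topspace X - \<Union>{D \<in> L n. p \<notin> D}"
    by (auto simp: core_def)
  ultimately show ?thesis
    by (simp add: openin_diff)
qed

lemma core_self: "p \<in> topspace X \<Longrightarrow> p \<in> core n p"
  by (simp add: core_def)

lemma core_antimono: "m \<le> n \<Longrightarrow> core n p \<subseteq> core m p"
  using mono[of m n] by (auto simp: core_def)

lemma finite_cover_in_level: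
  assumes "openin X U" "compactin X K" "K \<subseteq> U"
  obtains n \<F> where "finite \<F>" "\<F> \<subseteq> L n" "K \<subseteq> \<Union>\<F>" "\<Union>\<F> \<subseteq> U"
proof -
  obtain \<F> where \<F>: "finite \<F>" "\<F> \<subseteq> (\<Union>n. L n)" "K \<subseteq> \<Union>\<F>" "\<Union>\<F> \<subseteq> U"
    using k_network assms unfolding k_network_def by meson
  then obtain i where i: "\<And>D. D \<in> \<F> \<Longrightarrow> D \<in> L (i D)"
    by (metis UN_E subsetD)
  have "\<F> \<subseteq> L (Max (i ` \<F>))"
  proof
    fix D assume D: "D \<in> \<F>"
    then have "i D \<le> Max (i ` \<F>)"
      using \<F>(1) by simp
    then show "D \<in> L (Max (i ` \<F>))"
      using i[OF D] mono by blast
  qed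
  then show ?thesis
    using that \<F> by blast
qed

text \<open>The compact set \<open>K - U\<close> is covered by finitely many members that miss \<open>p\<close>, and the core
  of \<open>p\<close> at their level misses all of them.\<close>

lemma core_base_in_compact:
  assumes X: "Hausdorff_space X" and K: "compactin X K" and p: "p \<in> topspace X"
    and U: "openin X U" "p \<in> U"
  shows "\<exists>n. K \<inter> core n p \<subseteq> U"
proof -
  have "openin X (topspace X - {p})"
    using X p by (simp add: closedin_Hausdorff_singleton openin_diff)
  moreover have "K - U = (topspace X - U) \<inter> K"
    using compactin_subset_topspace[OF K] by blast
  then have "compactin X (K - U)"
    using closed_Int_compactin[OF _ K, of "topspace X - U"] U(1) by (simp add: closedin_diff)
  moreover have "K - U \<subseteq> topspace X - {p}"
    using U(2) compactin_subset_topspace[OF K] by blast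
  ultimately obtain n \<F> where "finite \<F>"
      and \<F>: "\<F> \<subseteq> L n" "K - U \<subseteq> \<Union>\<F>" "\<Union>\<F> \<subseteq> topspace X - {p}"
    by (rule finite_cover_in_level)
  have "q \<in> U" if q: "q \<in> K" "q \<in> core n p" for q
  proof (rule ccontr)
    assume "q \<notin> U"
    then obtain D where D: "D \<in> \<F>" "q \<in> D"
      using \<F>(2) q(1) by blast
    then have "p \<in> D"
      using q(2) \<F>(1) by (auto simp: core_def)
    then show False
      using D(1) \<F>(3) by blast
  qed
  then show ?thesis
    by blast
qed

text \<open>The cores of a cluster point form a decreasing countable base of its neighbourhoods inside
  the compact set.\<close>

lemma compactin_imp_convergent_subsequence:
  fixes s :: "nat \<Rightarrow> 'a"
  assumes X: "Hausdorff_space X" and K: "compactin X K" and s: "\<And>n. s n \<in> K"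
  obtains r p where "strict_mono r" "limitin X (s \<circ> r) p sequentially"
proof -
  obtain p where p: "p \<in> K" "\<forall>V. openin X V \<and> p \<in> V \<longrightarrow> infinite {n. s n \<in> V}"
    using compactin_imp_cluster_point[OF K s] by (rule bexE)
  then have pX: "p \<in> topspace X"
    using compactin_subset_topspace[OF K] by blast
  have "infinite {m. s m \<in> core n p}" for n
    using p(2) openin_core[of n p] core_self[OF pX, of n] by simp
  then have "\<exists>m>k. s m \<in> core n p" for k n
    by (auto simp: infinite_nat_iff_unbounded)
  then have "\<exists>r. \<forall>n. s (r n) \<in> core n p \<and> r n < r (Suc n)"
    by (intro dependent_nat_choice) auto
  then obtain r where r: "\<And>n. s (r n) \<in> core n p" "\<And>n. r n < r (Suc n)"
    by blast
  have "limitin X (s \<circ> r) p sequentially"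
    unfolding limitin_sequentially
  proof (intro conjI allI impI)
    fix U assume "openin X U \<and> p \<in> U"
    then obtain n where "K \<inter> core n p \<subseteq> U"
      using core_base_in_compact[OF X K pX] by blast
    then show "\<exists>n. \<forall>m\<ge>n. (s \<circ> r) m \<in> U"
      using r(1) core_antimono s by (metis IntI comp_apply subsetD)
  qed (rule pX)
  then show ?thesis
    using that r(2) strict_mono_Suc_iff by blast
qed

text \<open>A tail of the \<open>s n\<close> together with the limit is a compact subset of any given open
  neighbourhood of \<open>p\<close>, so it is covered by finitely many members inside that neighbourhood. Once
  \<open>n\<close> exceeds their level, the member around \<open>s n\<close> contains \<open>a n\<close> as well.\<close>

lemma limitin_of_core:
  fixes s a :: "nat \<Rightarrow> 'a"
  assumes lim: "limitin X s p sequentially" and r: "strict_mono r"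
    and core: "\<And>n. s n \<in> core (r n) (a n)"
  shows "limitin X a p sequentially"
  unfolding limitin_sequentially
proof (intro conjI allI impI)
  show "p \<in> topspace X"
    using lim limitin_topspace by metis
  fix U assume U: "openin X U \<and> p \<in> U"
  then obtain M where M: "\<And>n. M \<le> n \<Longrightarrow> s n \<in> U"
    using lim unfolding limitin_sequentially by blast
  have "openin X U"
    using U by blast
  moreover have "compactin X (insert p (s ` {M..}))"
    using core by (intro compactin_sequence_with_limit[OF lim]) (auto simp: core_def)
  moreover have "insert p (s ` {M..}) \<subseteq> U"
    using M U by auto
  ultimately obtain k \<F> where "finite \<F>"
      and \<F>: "\<F> \<subseteq> L k" "insert p (s ` {M..}) \<subseteq> \<Union>\<F>" "\<Union>\<F> \<subseteq> U"
    by (rule finite_cover_in_level)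
  have "a n \<in> U" if n: "max M k \<le> n" for n
  proof -
    obtain D where D: "D \<in> \<F>" "s n \<in> D"
      using \<F>(2) n by auto
    have "k \<le> r n"
      using n strict_mono_imp_increasing[OF r, of n] by simp
    then have "D \<in> L (r n)"
      using D(1) \<F>(1) mono by blast
    then have "a n \<in> D"
      using core[of n] D(2) by (simp add: core_def)
    then show ?thesis
      using D(1) \<F>(3) by blast
  qed
  then show "\<exists>N. \<forall>n\<ge>N. a n \<in> U"
    by blast
qed

text \<open>Infinitely many of the open expansions \<open>\<Union>a\<in>S n. core n a\<close> meet \<open>K\<close>; a convergent
  subsequence of the meeting points drags along points of the sets \<open>S n\<close> themselves.\<close>

lemma convergent_selection:
  fixes S :: "nat \<Rightarrow> 'a set"
  assumes X: "Hausdorff_space X" and K: "compactin X K"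
    and inf: "infinite {n. K \<inter> (\<Union>a\<in>S n. core n a) \<noteq> {}}"
  obtains r a p where "strict_mono r" "\<And>n. a n \<in> S (r n)" "limitin X a p sequentially"
proof -
  define e where "e = enumerate {n. K \<inter> (\<Union>a\<in>S n. core n a) \<noteq> {}}"
  have e: "strict_mono e"
    using inf by (simp add: e_def strict_mono_enumerate)
  have "K \<inter> (\<Union>a\<in>S (e n). core (e n) a) \<noteq> {}" for n
    using enumerate_in_set[OF inf, of n] unfolding e_def by simp
  then have "\<forall>n. \<exists>q b. q \<in> K \<and> b \<in> S (e n) \<and> q \<in> core (e n) b"
    by blast
  then obtain q b where qb: "\<And>n. q n \<in> K" "\<And>n. b n \<in> S (e n)" "\<And>n. q n \<in> core (e n) (b n)"
    by metis
  obtain t p where t: "strict_mono t" "limitin X (q \<circ> t) p sequentially"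
    by (rule compactin_imp_convergent_subsequence[OF X K qb(1)])
  have et: "strict_mono (e \<circ> t)"
    using e t(1) by (simp add: strict_mono_o)
  moreover have "limitin X (b \<circ> t) p sequentially"
    using limitin_of_core[OF t(2) et] qb(3) by simp
  ultimately show ?thesis
    using that[of "e \<circ> t" "b \<circ> t" p] qb(2) by simp
qed

end

section \<open>Bump functions in the compact-open topology\<close>

lemma openin_compact_open_subbasic:
  assumes "compactin X K" "open U"
  shows "openin (compact_open_topology X) {f \<in> cont_funs X. f ` K \<subseteq> U}"
  unfolding compact_open_topology_def using assms by (intro topology_generated_by_Basis) blast

lemma Hausdorff_space_compact_open_topology: "Hausdorff_space (compact_open_topology X)"
  unfolding Hausdorff_space_def topspace_compact_open_topology
proof (intro allI impI)
  fix f g assume fg: "f \<in> cont_funs X \<and> g \<in> cont_funs X \<and> f \<noteq> g"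
  then obtain x where x: "x \<in> topspace X" "f x \<noteq> g x"
    unfolding cont_funs_def by (metis (no_types, lifting) extensionalityI mem_Collect_eq)
  then obtain U V where UV: "open U" "open V" "f x \<in> U" "g x \<in> V" "U \<inter> V = {}"
    using hausdorff by metis
  show "\<exists>U V. openin (compact_open_topology X) U \<and> openin (compact_open_topology X) V \<and>
      f \<in> U \<and> g \<in> V \<and> disjnt U V"
    using x UV fg openin_compact_open_subbasic[of X "{x}"]
    by (intro exI[of _ "{h \<in> cont_funs X. h ` {x} \<subseteq> U}"]
        exI[of _ "{h \<in> cont_funs X. h ` {x} \<subseteq> V}"]) (auto simp: disjnt_iff)
qed

text \<open>On each compact set all but finitely many of the functions coincide with \<open>g\<close>, so they
  enter every subbasic neighbourhood of \<open>g\<close>.\<close>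

lemma limitin_compact_open_eventually_eq:
  fixes f :: "nat \<Rightarrow> 'a \<Rightarrow> real"
  assumes f: "\<And>n. f n \<in> cont_funs X" and g: "g \<in> cont_funs X"
    and eq: "\<And>K. compactin X K \<Longrightarrow> \<exists>M. \<forall>n\<ge>M. \<forall>x\<in>K. f n x = g x"
  shows "limitin (compact_open_topology X) f g sequentially"
  unfolding limitin_def
proof (intro conjI allI impI)
  show "g \<in> topspace (compact_open_topology X)"
    using g by simp
  fix V assume "openin (compact_open_topology X) V \<and> g \<in> V"
  then have "generate_topology_on {{f \<in> cont_funs X. f ` K \<subseteq> U} | K U. compactin X K \<and> open U} V"
    and "g \<in> V"
    unfolding compact_open_topology_def by (auto simp: openin_topology_generated_by_iff)
  then show "\<forall>\<^sub>F n in sequentially. f n \<in> V"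
  proof (induction rule: generate_topology_on.induct)
    case (Int A B)
    then show ?case
      by (simp add: eventually_conj_iff)
  next
    case (UN \<K>)
    then obtain A where A: "A \<in> \<K>" "g \<in> A"
      by blast
    then show ?case
      using UN.IH[OF A] by (auto elim: eventually_mono)
  next
    case (Basis A)
    then obtain K U where KU: "compactin X K" "A = {f \<in> cont_funs X. f ` K \<subseteq> U}"
      by blast
    obtain M where "\<forall>n\<ge>M. \<forall>x\<in>K. f n x = g x"
      using eq[OF KU(1)] by blast
    then have "\<forall>n\<ge>M. f n \<in> A"
      using Basis.prems f unfolding KU(2) by fastforce
    then show ?case
      using eventually_sequentially by blast
  qed simp
qed

text \<open>Urysohn functions that are \<open>1\<close> on \<open>S n\<close> and vanish off \<open>U n\<close> converge to zero in the
  compact-open topology. Joint continuity of evaluation at the zero function makes almost all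
  of them small on one common neighbourhood, which therefore misses almost all \<open>S n\<close>.\<close>

lemma cs_Ascoli_compact_finite_expansion:
  fixes S U :: "nat \<Rightarrow> 'a set"
  assumes X: "cs_Ascoli X" "normal_space X"
    and S: "\<And>n. closedin X (S n)" "\<And>n. S n \<noteq> {}"
    and U: "\<And>n. openin X (U n)" "\<And>n. S n \<subseteq> U n"
    and fin: "\<And>K. compactin X K \<Longrightarrow> finite {n. K \<inter> U n \<noteq> {}}"
    and x: "x \<in> topspace X"
  shows "\<exists>V. openin X V \<and> x \<in> V \<and> finite {n. V \<inter> S n \<noteq> {}}"
proof -
  let ?C = "compact_open_topology X"
  define z where "z = restrict (\<lambda>_. 0 :: real) (topspace X)"
  have z: "z \<in> cont_funs X"
    by (auto simp: z_def cont_funs_def intro: continuous_map_eq[of X _ "\<lambda>_. 0"])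
  have "\<exists>f\<in>cont_funs X. (\<forall>y\<in>S n. f y = 1) \<and> (\<forall>y\<in>topspace X - U n. f y = 0)" for n
  proof -
    have "closedin X (topspace X - U n)" "disjnt (S n) (topspace X - U n)"
      using U[of n] by (auto simp: disjnt_iff)
    then obtain h where h: "continuous_map X euclideanreal h" "h ` S n \<subseteq> {1}"
        "h ` (topspace X - U n) \<subseteq> {0}"
      using Urysohn_lemma_alt[OF X(2) S(1)] by metis
    have "restrict h (topspace X) \<in> cont_funs X"
      using h(1) by (auto simp: cont_funs_def intro: continuous_map_eq)
    then show ?thesis
      using h(2,3) closedin_subset[OF S(1)[of n]]
      by (intro bexI[of _ "restrict h (topspace X)"]) (auto simp: image_subset_iff)
  qed
  then obtain f where f: "\<And>n. f n \<in> cont_funs X" "\<And>n y. y \<in> S n \<Longrightarrow> f n y = 1"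
      "\<And>n y. y \<in> topspace X \<Longrightarrow> y \<notin> U n \<Longrightarrow> f n y = 0"
    by (metis DiffI)
  have ne: "f n \<noteq> z" for n
  proof -
    obtain y where "y \<in> S n"
      using S(2) by blast
    then have "f n y = 1" "z y = 0"
      using f(2) closedin_subset[OF S(1)[of n]] by (auto simp: z_def)
    then show ?thesis
      by auto
  qed
  have lim: "limitin ?C f z sequentially"
  proof (rule limitin_compact_open_eventually_eq[OF f(1) z])
    fix K assume K: "compactin X K"
    obtain M where "\<And>n. n \<in> {n. K \<inter> U n \<noteq> {}} \<Longrightarrow> n < M"
      using fin[OF K] finite_nat_set_iff_bounded by metis
    then have "\<forall>n\<ge>M. K \<inter> U n = {}"
      by (meson mem_Collect_eq not_le)
    then show "\<exists>M. \<forall>n\<ge>M. \<forall>y\<in>K. f n y = z y"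
      using f(3) compactin_subset_topspace[OF K] unfolding z_def
      by (metis disjoint_iff restrict_apply' subsetD)
  qed
  let ?K = "insert z (range f)"
  let ?P = "prod_topology (subtopology ?C ?K) X"
  have "convergent_sequence_in ?C ?K"
    using convergent_sequence_in_insert_range[OF Hausdorff_space_compact_open_topology lim] f(1) ne
    by auto
  then have "continuous_map ?P euclideanreal (\<lambda>(f, x). f x)"
    using X(1) unfolding cs_Ascoli_def by blast
  then have "openin ?P {w \<in> topspace ?P. (\<lambda>(f, x). f x) w \<in> {..<1}}"
    by (rule openin_continuous_map_preimage) simp
  moreover have "(z, x) \<in> {w \<in> topspace ?P. (\<lambda>(f, x). f x) w \<in> {..<1}}"
    using x z by (simp add: z_def)
  ultimately obtain A V where AV: "openin (subtopology ?C ?K) A" "openin X V" "z \<in> A" "x \<in> V"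
      "A \<times> V \<subseteq> {w \<in> topspace ?P. (\<lambda>(f, x). f x) w \<in> {..<1}}"
    unfolding openin_prod_topology_alt by meson
  obtain B where B: "openin ?C B" "A = B \<inter> ?K"
    using AV(1) by (auto simp: openin_subtopology)
  then obtain M where M: "\<And>n. M \<le> n \<Longrightarrow> f n \<in> B"
    using lim AV(3) unfolding limitin_sequentially by blast
  have "n < M" if n: "V \<inter> S n \<noteq> {}" for n
  proof (rule ccontr)
    assume "\<not> n < M"
    then have "f n \<in> A"
      using M B(2) by simp
    moreover obtain y where "y \<in> V" "y \<in> S n"
      using n by blast
    ultimately show False
      using AV(5) f(2) by fastforce
  qed
  then have "{n. V \<inter> S n \<noteq> {}} \<subseteq> {..<M}"
    by auto
  then have "finite {n. V \<inter> S n \<noteq> {}}"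
    using finite_subset by blast
  then show ?thesis
    using AV(2,4) by blast
qed

section \<open>Accumulating closed sets\<close>

text \<open>Either some compact set meets infinitely many of the expansions, or they form a compact-finite
  family and the cs-Ascoli property contradicts accumulation at \<open>x\<close>.\<close>

lemma closedin_convergent_selection:
  fixes S :: "nat \<Rightarrow> 'a set"
  assumes X: "cs_Ascoli X" "normal_space X" "aleph_space X"
    and S: "\<And>n. closedin X (S n)" and acc: "accumulates_at X S x"
  obtains r a p where "strict_mono r" "\<And>n. a n \<in> S (r n)" "limitin X a p sequentially"
proof -
  obtain L where "leveled_k_network X L"
    using aleph_space_imp_leveled_k_network[OF X(3)] by blast
  then interpret leveled_k_network X L .
  have x: "x \<in> topspace X" and acc: "\<And>V. openin X V \<Longrightarrow> x \<in> V \<Longrightarrow> infinite {n. V \<inter> S n \<noteq> {}}"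
    using acc by (auto simp: accumulates_at_def)
  have Hausdorff: "Hausdorff_space X"
    using X(3) by (simp add: aleph_space_def)
  \<comment> \<open>The empty sets are dropped because the bump function of an empty set could be zero, while
    a convergent sequence needs infinitely many distinct terms.\<close>
  define J where "J = {n. S n \<noteq> {}}"
  have "infinite J"
    using acc[OF openin_topspace x] by (rule infinite_super[rotated]) (auto simp: J_def)
  define e where "e = enumerate J"
  have e: "strict_mono e" "range e = J"
    using \<open>infinite J\<close> by (simp_all add: e_def strict_mono_enumerate range_enumerate)
  define T where "T n = S (e n)" for n
  have T: "closedin X (T n)" "T n \<noteq> {}" for n
    using S e(2) by (auto simp: T_def J_def)
  show ?thesis
  proof (cases "\<exists>K. compactin X K \<and> infinite {n. K \<inter> (\<Union>a\<in>T n. core n a) \<noteq> {}}")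
    case True
    then obtain K where K: "compactin X K" "infinite {n. K \<inter> (\<Union>a\<in>T n. core n a) \<noteq> {}}"
      by blast
    obtain r a p where "strict_mono r" "\<And>n. a n \<in> T (r n)" "limitin X a p sequentially"
      using convergent_selection[OF Hausdorff K] by blast
    then show ?thesis
      using that[of "e \<circ> r" a p] e(1) by (simp add: T_def strict_mono_o)
  next
    case False
    have "\<exists>V. openin X V \<and> x \<in> V \<and> finite {n. V \<inter> T n \<noteq> {}}"
    proof (rule cs_Ascoli_compact_finite_expansion[OF X(1,2) T _ _ _ x])
      show "openin X (\<Union>a\<in>T n. core n a)" for n
        using openin_core by blast
      show "T n \<subseteq> (\<Union>a\<in>T n. core n a)" for n
        using core_self closedin_subset[OF T(1)] by blast
      show "finite {n. K \<inter> (\<Union>a\<in>T n. core n a) \<noteq> {}}" if "compactin X K" for K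
        using False that by blast
    qed
    then obtain V where V: "openin X V" "x \<in> V" "finite {n. V \<inter> T n \<noteq> {}}"
      by blast
    have "{n. V \<inter> S n \<noteq> {}} \<subseteq> e ` {n. V \<inter> T n \<noteq> {}}"
    proof
      fix n assume n: "n \<in> {n. V \<inter> S n \<noteq> {}}"
      then have "n \<in> range e"
        unfolding e(2) J_def by blast
      then show "n \<in> e ` {n. V \<inter> T n \<noteq> {}}"
        using n by (auto simp: T_def)
    qed
    then show ?thesis
      using acc[OF V(1,2)] V(3) finite_surj by blast
  qed
qed

text \<open>Intersecting the sets with a closed neighbourhood of \<open>x\<close> inside \<open>U\<close> forces the limit of
  the selected points into \<open>U\<close>, where the defining property of a cs-network applies.\<close>

lemma cs_network_imp_as_network:
  assumes X: "cs_Ascoli X" "normal_space X" "aleph_space X" and \<N>: "cs_network X \<N>"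
  shows "as_network X \<N>"
  unfolding as_network_def
proof (intro conjI allI impI)
  show "\<N> \<subseteq> Pow (topspace X)"
    using \<N> by (simp add: cs_network_def)
  fix U and S :: "nat \<Rightarrow> 'a set" and x
  assume A: "openin X U \<and> (\<forall>n. closedin X (S n)) \<and> accumulates_at X S x \<and> x \<in> U"
  then have x: "x \<in> topspace X - (topspace X - U)" "closedin X (topspace X - U)"
    by (auto simp: accumulates_at_def)
  have "regular_space X"
    using X(3) by (simp add: aleph_space_def)
  then obtain W where W: "openin X W" "x \<in> W" "disjnt (topspace X - U) (X closure_of W)"
    using x unfolding regular_space by blast
  have WU: "X closure_of W \<subseteq> U"
    using W(3) closure_of_subset_topspace[of X W] by (auto simp: disjnt_iff)
  have accumulates: "accumulates_at X (\<lambda>n. S n \<inter> X closure_of W) x"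
    unfolding accumulates_at_def
  proof (intro conjI allI impI)
    fix V assume V: "openin X V \<and> x \<in> V"
    then have "infinite {n. (V \<inter> W) \<inter> S n \<noteq> {}}"
      using A W(1,2) by (simp add: accumulates_at_def openin_Int)
    then show "infinite {n. V \<inter> (S n \<inter> X closure_of W) \<noteq> {}}"
      by (rule infinite_super[rotated])
        (use closure_of_subset[OF openin_subset[OF W(1)]] in blast)
  qed (use x in blast)
  have "closedin X (S n \<inter> X closure_of W)" for n
    using A by (simp add: closedin_Int)
  then obtain r a p where r: "strict_mono r" and a: "\<And>n. a n \<in> S (r n) \<inter> X closure_of W"
      and lim: "limitin X a p sequentially"
    using closedin_convergent_selection[OF X, of "\<lambda>n. S n \<inter> X closure_of W"] accumulates by blast
  have "p \<in> X closure_of W"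
    using lim a by (intro limitin_closedin[OF lim]) auto
  moreover have "range a \<subseteq> topspace X"
    using a closure_of_subset_topspace[of X W] by blast
  ultimately obtain N where N: "N \<in> \<N>" "N \<subseteq> U" "infinite {n. a n \<in> N}"
    using \<N> A lim WU unfolding cs_network_def by (meson subsetD)
  have "inj_on r {n. a n \<in> N}"
    by (simp add: inj_on_def strict_mono_eq[OF r])
  then have "infinite (r ` {n. a n \<in> N})"
    using N(3) by (simp add: finite_image_iff)
  moreover have "r ` {n. a n \<in> N} \<subseteq> {n. N \<inter> S n \<noteq> {}}"
    using a by blast
  ultimately have "infinite {n. N \<inter> S n \<noteq> {}}"
    using infinite_super by blast
  then show "\<exists>N\<in>\<N>. N \<subseteq> U \<and> infinite {n. N \<inter> S n \<noteq> {}}"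
    using N by blast
qed

theorem theorem1p10:
  fixes X :: "'a topology"
  assumes "cs_Ascoli X" and "normal_space X" and "aleph_space X"
  shows "(\<forall>\<N>. cs_network X \<N> \<longrightarrow> as_network X \<N>) \<and> sigma_as_space X"
  using cs_network_imp_as_network[OF assms] k_network_imp_cs_network assms(3)
  unfolding sigma_as_space_def aleph_space_def by blast

end
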